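(* Let $F\colon X\to\overline{\mathbb R}$ and $G\colon X\to\overline{\mathbb R}$ be diconvex mappings on the real Banach space $X$. Then, for every $u\in X$, $$\partial_\beta F(u)+\partial_\beta G(u)\subset\partial_\beta[F+G](u).$$
   Context: $\overline{\mathbb R}=\mathbb R\cup\{\pm\infty\}$; a functional is proper if it is never $-\infty$ and not identically $+\infty$. $X\otimes_{\pi,\mathrm{sym}}X$ is the closed subspace of the (completed) projective tensor product $X\otimes_\pi X$ spanned by the tensors $u\otimes u$, $u\in X$. A mapping $F\colon X\to\overline{\mathbb R}$ is diconvex if there is a proper, convex $\breve F\colon X\times(X\otimes_{\pi,\mathrm{sym}}X)\to\overline{\mathbb R}$ with $F(u)=\breve F(u,u\otimes u)$ for all $u\in X$. The dilinear subdifferential $\partial_\beta F(u)$ of $F\colon X\to\overline{\mathbb R}$ at $u$ is the set of all $(\xi,\Xi)\in X^*\times(X\otimes_{\pi,\mathrm{sym}}X)^*$ such that $F(u)$ is finite and $F(v)\ge F(u)+\langle\xi,v-u\rangle+\langle\Xi,v\otimes v-u\otimes u\rangle$ for all $v\in X$ (empty if no such element exists). *)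

theory Defs
  imports "HOL-Analysis.Analysis"
begin

section \<open>The algebraic tensor product\<close>

text \<open>
  The algebraic tensor product of two real vector spaces is realised as the space of linear
  functionals on the bilinear forms that is spanned by the evaluations
  \<open>x \<otimes> y : B \<mapsto> B x y\<close>.  Scalars can be absorbed into the
  factors, so its elements are exactly the functionals given by finite lists of pairs.
  Functions that are not bilinear are irrelevant and are sent to 0.
\<close>

definition tensor_eval :: "('a::real_vector \<times> 'b::real_vector) list \<Rightarrow> ('a \<Rightarrow> 'b \<Rightarrow> real) \<Rightarrow> real" where
  "tensor_eval zs B = (if bilinear B then \<Sum>(x, y)\<leftarrow>zs. B x y else 0)"

lemma tensor_eval_Nil: "tensor_eval [] = (\<lambda>B. 0)"
  by (auto simp: tensor_eval_def)

lemma tensor_eval_append: "tensor_eval (zs @ ws) = (\<lambda>B. tensor_eval zs B + tensor_eval ws B)"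
  by (auto simp: tensor_eval_def)

lemma tensor_eval_scale:
  "tensor_eval (map (\<lambda>(x, y). (r *\<^sub>R x, y)) zs) = (\<lambda>B. r * tensor_eval zs B)"
proof
  fix B :: "'a \<Rightarrow> 'b \<Rightarrow> real"
  show "tensor_eval (map (\<lambda>(x, y). (r *\<^sub>R x, y)) zs) B = r * tensor_eval zs B"
    by (induction zs) (auto simp: tensor_eval_def bilinear_lmul algebra_simps)
qed

typedef (overloaded) ('a::real_vector, 'b::real_vector) alg_tensor =
  "range (tensor_eval :: ('a \<times> 'b) list \<Rightarrow> _)"
  by blast

setup_lifting type_definition_alg_tensor

lift_definition list_tensor :: "('a::real_vector \<times> 'b::real_vector) list \<Rightarrow> ('a, 'b) alg_tensor"
  is tensor_eval by blast

lemma list_tensor_cases: obtains zs where "z = list_tensor zs"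
  by transfer auto

instantiation alg_tensor :: (real_vector, real_vector) real_vector
begin

lift_definition zero_alg_tensor :: "('a, 'b) alg_tensor" is "\<lambda>B. 0"
  unfolding tensor_eval_Nil[symmetric] by (rule rangeI)

lift_definition plus_alg_tensor :: "('a, 'b) alg_tensor \<Rightarrow> ('a, 'b) alg_tensor \<Rightarrow> ('a, 'b) alg_tensor"
  is "\<lambda>f g B. f B + g B"
  by (clarsimp simp flip: tensor_eval_append)

lift_definition scaleR_alg_tensor :: "real \<Rightarrow> ('a, 'b) alg_tensor \<Rightarrow> ('a, 'b) alg_tensor"
  is "\<lambda>r f B. r * f B"
  by (clarsimp simp flip: tensor_eval_scale)

definition uminus_alg_tensor :: "('a, 'b) alg_tensor \<Rightarrow> ('a, 'b) alg_tensor"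
  where "uminus_alg_tensor z = (-1) *\<^sub>R z"

definition minus_alg_tensor :: "('a, 'b) alg_tensor \<Rightarrow> ('a, 'b) alg_tensor \<Rightarrow> ('a, 'b) alg_tensor"
  where "minus_alg_tensor z w = z + (-1) *\<^sub>R w"

instance
  by standard
    (unfold uminus_alg_tensor_def minus_alg_tensor_def, (transfer, simp add: algebra_simps)+)

end

lemma list_tensor_Nil: "list_tensor [] = 0"
  by transfer (rule tensor_eval_Nil)

lemma list_tensor_append: "list_tensor (zs @ ws) = list_tensor zs + list_tensor ws"
  by transfer (rule tensor_eval_append)

lemma list_tensor_scale:
  "list_tensor (map (\<lambda>(x, y). (r *\<^sub>R x, y)) zs) = r *\<^sub>R list_tensor zs"
  by transfer (rule tensor_eval_scale)

lemma list_tensor_Cons: "list_tensor (z # zs) = list_tensor [z] + list_tensor zs"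
  using list_tensor_append[of "[z]" zs] by simp

lemma bilinear_elementary:
  "bilinear (\<lambda>(x::'a::real_vector) (y::'b::real_vector). list_tensor [(x, y)])"
  unfolding bilinear_def
  by (intro conjI allI linearI; transfer;
      auto simp: tensor_eval_def bilinear_ladd bilinear_radd bilinear_lmul bilinear_rmul)

lifting_update alg_tensor.lifting
lifting_forget alg_tensor.lifting


section \<open>The projective norm\<close>

definition list_cost :: "('a::real_normed_vector \<times> 'b::real_normed_vector) list \<Rightarrow> real" where
  "list_cost zs = (\<Sum>(x, y)\<leftarrow>zs. norm x * norm y)"

definition proj_norm :: "('a::real_normed_vector, 'b::real_normed_vector) alg_tensor \<Rightarrow> real" where
  "proj_norm z = Inf {list_cost zs | zs. z = list_tensor zs}"

lemma list_cost_nonneg: "0 \<le> list_cost zs"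
  unfolding list_cost_def by (rule sum_list_nonneg) auto

lemma proj_norm_le: "proj_norm (list_tensor zs) \<le> list_cost zs"
  unfolding proj_norm_def
  by (rule cInf_lower) (auto intro!: bdd_belowI[of _ 0] list_cost_nonneg)

lemma proj_norm_approx:
  assumes "0 < e" obtains zs where "z = list_tensor zs" "list_cost zs < proj_norm z + e"
proof -
  have "{list_cost zs | zs. z = list_tensor zs} \<noteq> {}"
    using list_tensor_cases[of z] by auto
  from cInf_lessD[OF this, of "proj_norm z + e"] assms that show thesis
    by (auto simp: proj_norm_def)
qed

lemma proj_norm_nonneg: "0 \<le> proj_norm z"
  unfolding proj_norm_def
  by (rule cInf_greatest) (use list_tensor_cases[of z] list_cost_nonneg in auto)

lemma proj_norm_0: "proj_norm 0 = 0"
  using proj_norm_le[of "[]"] by (intro antisym proj_norm_nonneg) (simp add: list_tensor_Nil list_cost_def)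

lemma proj_norm_add: "proj_norm (z + w) \<le> proj_norm z + proj_norm w"
proof (rule field_le_epsilon)
  fix e :: real assume "0 < e"
  then have "0 < e / 2" by simp
  obtain zs where zs: "z = list_tensor zs" "list_cost zs < proj_norm z + e / 2"
    using proj_norm_approx[OF \<open>0 < e / 2\<close>] .
  obtain ws where ws: "w = list_tensor ws" "list_cost ws < proj_norm w + e / 2"
    using proj_norm_approx[OF \<open>0 < e / 2\<close>] .
  have "proj_norm (z + w) \<le> list_cost (zs @ ws)"
    using proj_norm_le[of "zs @ ws"] by (simp add: zs(1) ws(1) list_tensor_append)
  also have "\<dots> = list_cost zs + list_cost ws" by (simp add: list_cost_def)
  finally show "proj_norm (z + w) \<le> proj_norm z + proj_norm w + e" using zs ws by simp
qed

lemma proj_norm_scaleR_le: "proj_norm (r *\<^sub>R z) \<le> \<bar>r\<bar> * proj_norm z"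
proof (rule field_le_epsilon)
  fix e :: real assume "0 < e"
  define d where "d = e / (\<bar>r\<bar> + 1)"
  have "0 < d" using \<open>0 < e\<close> by (simp add: d_def)
  then obtain zs where zs: "z = list_tensor zs" "list_cost zs < proj_norm z + d"
    using proj_norm_approx by blast
  have "list_cost (map (\<lambda>(x, y). (r *\<^sub>R x, y)) zs) = \<bar>r\<bar> * list_cost zs"
    by (induction zs) (auto simp: list_cost_def algebra_simps)
  then have "proj_norm (r *\<^sub>R z) \<le> \<bar>r\<bar> * list_cost zs"
    using proj_norm_le[of "map (\<lambda>(x, y). (r *\<^sub>R x, y)) zs"] by (simp add: zs(1) list_tensor_scale)
  also have "\<dots> \<le> \<bar>r\<bar> * (proj_norm z + d)"
    using zs(2) by (intro mult_left_mono) auto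
  also have "\<bar>r\<bar> * (proj_norm z + d) \<le> \<bar>r\<bar> * proj_norm z + (\<bar>r\<bar> + 1) * d"
    using \<open>0 < d\<close> by (simp add: ring_distribs)
  also have "(\<bar>r\<bar> + 1) * d = e" by (simp add: d_def)
  finally show "proj_norm (r *\<^sub>R z) \<le> \<bar>r\<bar> * proj_norm z + e" .
qed

lemma proj_norm_scaleR: "proj_norm (r *\<^sub>R z) = \<bar>r\<bar> * proj_norm z"
proof (cases "r = 0")
  case True
  then show ?thesis by (simp add: proj_norm_0)
next
  case False
  have "proj_norm (inverse r *\<^sub>R (r *\<^sub>R z)) \<le> \<bar>inverse r\<bar> * proj_norm (r *\<^sub>R z)"
    by (rule proj_norm_scaleR_le)
  then have "\<bar>r\<bar> * proj_norm z \<le> proj_norm (r *\<^sub>R z)"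
    using False by (simp add: field_simps)
  then show ?thesis using proj_norm_scaleR_le[of r z] by simp
qed

lemma proj_norm_minus: "proj_norm (- z) = proj_norm z"
  using proj_norm_scaleR[of "-1" z] by simp

lemma proj_norm_minus_commute: "proj_norm (z - w) = proj_norm (w - z)"
  using proj_norm_minus[of "z - w"] by simp

lemma proj_norm_triangle: "proj_norm (x - z) \<le> proj_norm (x - y) + proj_norm (y - z)"
  using proj_norm_add[of "x - y" "y - z"] by simp

lemma proj_norm_diff: "\<bar>proj_norm x - proj_norm y\<bar> \<le> proj_norm (x - y)"
  using proj_norm_add[of "x - y" y] proj_norm_add[of "y - x" x] proj_norm_minus_commute[of x y]
  by simp


section \<open>The completed projective tensor product\<close>

text \<open>
  The completion consists of the Cauchy sequences for the projective norm, modulo null sequences.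
  That \<^const>\<open>proj_norm\<close> is definite (by Hahn-Banach) is not needed for this construction.
\<close>

definition pcauchy :: "(nat \<Rightarrow> ('a::real_normed_vector, 'b::real_normed_vector) alg_tensor) \<Rightarrow> bool" where
  "pcauchy X \<longleftrightarrow> (\<forall>e>0. \<exists>N. \<forall>m\<ge>N. \<forall>n\<ge>N. proj_norm (X m - X n) < e)"

definition pcauchy_rel ::
  "(nat \<Rightarrow> ('a::real_normed_vector, 'b::real_normed_vector) alg_tensor) \<Rightarrow> (nat \<Rightarrow> ('a, 'b) alg_tensor) \<Rightarrow> bool" where
  "pcauchy_rel X Y \<longleftrightarrow> pcauchy X \<and> pcauchy Y \<and> (\<lambda>n. proj_norm (X n - Y n)) \<longlonglongrightarrow> 0"

lemma pcauchy_const: "pcauchy (\<lambda>n. z)"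
  by (auto simp: pcauchy_def proj_norm_0)

lemma pcauchy_add:
  assumes "pcauchy X" "pcauchy Y" shows "pcauchy (\<lambda>n. X n + Y n)"
  unfolding pcauchy_def
proof (intro allI impI)
  fix e :: real assume "0 < e"
  then have "0 < e / 2" by simp
  obtain M where M: "\<And>m n. m \<ge> M \<Longrightarrow> n \<ge> M \<Longrightarrow> proj_norm (X m - X n) < e / 2"
    using assms(1) \<open>0 < e / 2\<close> unfolding pcauchy_def by blast
  obtain N where N: "\<And>m n. m \<ge> N \<Longrightarrow> n \<ge> N \<Longrightarrow> proj_norm (Y m - Y n) < e / 2"
    using assms(2) \<open>0 < e / 2\<close> unfolding pcauchy_def by blast
  have "proj_norm (X m + Y m - (X n + Y n)) < e" if "m \<ge> max M N" "n \<ge> max M N" for m n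
    using M[of m n] N[of m n] that proj_norm_add[of "X m - X n" "Y m - Y n"]
    by (simp add: algebra_simps)
  then show "\<exists>N. \<forall>m\<ge>N. \<forall>n\<ge>N. proj_norm (X m + Y m - (X n + Y n)) < e" by blast
qed

lemma pcauchy_scaleR:
  assumes "pcauchy X" shows "pcauchy (\<lambda>n. r *\<^sub>R X n)"
  unfolding pcauchy_def
proof (intro allI impI)
  fix e :: real assume "0 < e"
  then have "0 < e / (\<bar>r\<bar> + 1)" by simp
  then obtain N where N: "\<And>m n. m \<ge> N \<Longrightarrow> n \<ge> N \<Longrightarrow> proj_norm (X m - X n) < e / (\<bar>r\<bar> + 1)"
    using assms unfolding pcauchy_def by blast
  have "proj_norm (r *\<^sub>R X m - r *\<^sub>R X n) < e" if "m \<ge> N" "n \<ge> N" for m n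
  proof -
    have "proj_norm (r *\<^sub>R X m - r *\<^sub>R X n) = \<bar>r\<bar> * proj_norm (X m - X n)"
      by (simp add: proj_norm_scaleR flip: scaleR_diff_right)
    also have "\<dots> \<le> (\<bar>r\<bar> + 1) * proj_norm (X m - X n)"
      using proj_norm_nonneg[of "X m - X n"] by (intro mult_right_mono) auto
    also have "\<dots> < e" using N[OF that] by (simp add: field_simps)
    finally show ?thesis .
  qed
  then show "\<exists>N. \<forall>m\<ge>N. \<forall>n\<ge>N. proj_norm (r *\<^sub>R X m - r *\<^sub>R X n) < e" by blast
qed

lemma pcauchy_proj_norm:
  assumes "pcauchy X" shows "convergent (\<lambda>n. proj_norm (X n))"
proof -
  have "Cauchy (\<lambda>n. proj_norm (X n))"
    unfolding Cauchy_def dist_real_def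
    using assms unfolding pcauchy_def by (meson proj_norm_diff order_le_less_trans)
  then show ?thesis by (simp add: Cauchy_convergent_iff)
qed

lemma null_squeeze:
  assumes "\<And>n. proj_norm (Z n) \<le> f n" "f \<longlonglongrightarrow> 0"
  shows "(\<lambda>n. proj_norm (Z n)) \<longlonglongrightarrow> 0"
  by (rule tendsto_sandwich[OF _ _ tendsto_const assms(2)])
     (auto simp: proj_norm_nonneg assms(1))

quotient_type (overloaded) ('a, 'b) ptensor =
  "nat \<Rightarrow> ('a::real_normed_vector, 'b::real_normed_vector) alg_tensor" / partial: pcauchy_rel
proof (rule part_equivpI)
  show "\<exists>X :: nat \<Rightarrow> ('a, 'b) alg_tensor. pcauchy_rel X X"
    using pcauchy_const[of 0] by (auto simp: pcauchy_rel_def proj_norm_0)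
  show "symp (pcauchy_rel :: (nat \<Rightarrow> ('a, 'b) alg_tensor) \<Rightarrow> _)"
    by (rule sympI) (simp add: pcauchy_rel_def proj_norm_minus_commute)
  show "transp (pcauchy_rel :: (nat \<Rightarrow> ('a, 'b) alg_tensor) \<Rightarrow> _)"
  proof (rule transpI)
    fix X Y Z :: "nat \<Rightarrow> ('a, 'b) alg_tensor"
    assume *: "pcauchy_rel X Y" "pcauchy_rel Y Z"
    have "(\<lambda>n. proj_norm (X n - Y n) + proj_norm (Y n - Z n)) \<longlonglongrightarrow> 0 + 0"
      using * unfolding pcauchy_rel_def by (intro tendsto_add) auto
    then have "(\<lambda>n. proj_norm (X n - Z n)) \<longlonglongrightarrow> 0"
      by (intro null_squeeze[OF proj_norm_triangle]) auto
    with * show "pcauchy_rel X Z" by (simp add: pcauchy_rel_def)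
  qed
qed

instantiation ptensor :: (real_normed_vector, real_normed_vector) real_normed_vector
begin

lift_definition zero_ptensor :: "('a, 'b) ptensor" is "\<lambda>n. 0"
  by (simp add: pcauchy_rel_def pcauchy_const proj_norm_0)

lift_definition plus_ptensor :: "('a, 'b) ptensor \<Rightarrow> ('a, 'b) ptensor \<Rightarrow> ('a, 'b) ptensor"
  is "\<lambda>X Y n. X n + Y n"
proof -
  fix X X' Y Y' :: "nat \<Rightarrow> ('a, 'b) alg_tensor"
  assume *: "pcauchy_rel X X'" "pcauchy_rel Y Y'"
  have "(\<lambda>n. proj_norm (X n - X' n) + proj_norm (Y n - Y' n)) \<longlonglongrightarrow> 0 + 0"
    using * unfolding pcauchy_rel_def by (intro tendsto_add) auto
  moreover have "proj_norm (X n + Y n - (X' n + Y' n)) \<le> proj_norm (X n - X' n) + proj_norm (Y n - Y' n)" for n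
    using proj_norm_add[of "X n - X' n" "Y n - Y' n"] by (simp add: algebra_simps)
  ultimately have "(\<lambda>n. proj_norm (X n + Y n - (X' n + Y' n))) \<longlonglongrightarrow> 0"
    by (intro null_squeeze) auto
  with * show "pcauchy_rel (\<lambda>n. X n + Y n) (\<lambda>n. X' n + Y' n)"
    by (auto simp: pcauchy_rel_def intro: pcauchy_add)
qed

lift_definition scaleR_ptensor :: "real \<Rightarrow> ('a, 'b) ptensor \<Rightarrow> ('a, 'b) ptensor"
  is "\<lambda>r X n. r *\<^sub>R X n"
proof -
  fix r :: real and X X' :: "nat \<Rightarrow> ('a, 'b) alg_tensor"
  assume *: "pcauchy_rel X X'"
  have "(\<lambda>n. \<bar>r\<bar> * proj_norm (X n - X' n)) \<longlonglongrightarrow> \<bar>r\<bar> * 0"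
    using * unfolding pcauchy_rel_def by (intro tendsto_mult_left) auto
  then have "(\<lambda>n. proj_norm (r *\<^sub>R X n - r *\<^sub>R X' n)) \<longlonglongrightarrow> 0"
    by (simp add: proj_norm_scaleR flip: scaleR_diff_right)
  with * show "pcauchy_rel (\<lambda>n. r *\<^sub>R X n) (\<lambda>n. r *\<^sub>R X' n)"
    by (auto simp: pcauchy_rel_def intro: pcauchy_scaleR)
qed

lift_definition norm_ptensor :: "('a, 'b) ptensor \<Rightarrow> real" is "\<lambda>X. lim (\<lambda>n. proj_norm (X n))"
proof -
  fix X Y :: "nat \<Rightarrow> ('a, 'b) alg_tensor"
  assume *: "pcauchy_rel X Y"
  have "(\<lambda>n. proj_norm (X n) - proj_norm (Y n)) \<longlonglongrightarrow> 0"
    by (rule Lim_null_comparison[of _ "\<lambda>n. proj_norm (X n - Y n)"])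
       (use * in \<open>auto simp: pcauchy_rel_def proj_norm_diff\<close>)
  moreover have "(\<lambda>n. proj_norm (Y n)) \<longlonglongrightarrow> lim (\<lambda>n. proj_norm (Y n))"
    using * pcauchy_proj_norm by (auto simp: pcauchy_rel_def convergent_LIMSEQ_iff)
  ultimately have "(\<lambda>n. proj_norm (X n)) \<longlonglongrightarrow> lim (\<lambda>n. proj_norm (Y n))"
    using tendsto_add by fastforce
  then show "lim (\<lambda>n. proj_norm (X n)) = lim (\<lambda>n. proj_norm (Y n))" by (rule limI)
qed

definition uminus_ptensor :: "('a, 'b) ptensor \<Rightarrow> ('a, 'b) ptensor"
  where "uminus_ptensor x = (-1) *\<^sub>R x"

definition minus_ptensor :: "('a, 'b) ptensor \<Rightarrow> ('a, 'b) ptensor \<Rightarrow> ('a, 'b) ptensor"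
  where "minus_ptensor x y = x + (-1) *\<^sub>R y"

definition dist_ptensor :: "('a, 'b) ptensor \<Rightarrow> ('a, 'b) ptensor \<Rightarrow> real"
  where "dist_ptensor x y = norm (x - y)"

definition uniformity_ptensor :: "(('a, 'b) ptensor \<times> ('a, 'b) ptensor) filter"
  where "uniformity_ptensor = (INF e\<in>{0 <..}. principal {(x, y). dist x y < e})"

definition open_ptensor :: "('a, 'b) ptensor set \<Rightarrow> bool"
  where "open_ptensor S = (\<forall>x\<in>S. \<forall>\<^sub>F (x', y) in uniformity. x' = x \<longrightarrow> y \<in> S)"

definition sgn_ptensor :: "('a, 'b) ptensor \<Rightarrow> ('a, 'b) ptensor"
  where "sgn_ptensor x = inverse (norm x) *\<^sub>R x"

lemma pcauchy_rel_refl: "pcauchy X \<Longrightarrow> pcauchy_rel X X"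
  by (simp add: pcauchy_rel_def proj_norm_0)

lemma pcauchy_rel_D: "pcauchy_rel X X \<Longrightarrow> pcauchy X"
  by (simp add: pcauchy_rel_def)

lemma pcauchy_lim: "pcauchy X \<Longrightarrow> (\<lambda>n. proj_norm (X n)) \<longlonglongrightarrow> lim (\<lambda>n. proj_norm (X n))"
  using pcauchy_proj_norm by (auto simp: convergent_LIMSEQ_iff)

instance
proof
  fix x y z :: "('a, 'b) ptensor" and a b :: real
  show "x + y + z = x + (y + z)"
    by transfer (auto simp: add.assoc dest!: pcauchy_rel_D intro!: pcauchy_rel_refl pcauchy_add)
  show "x + y = y + x"
    by transfer (auto simp: add.commute dest!: pcauchy_rel_D intro!: pcauchy_rel_refl pcauchy_add)
  show "0 + x = x"
    by transfer simp
  show "- x + x = 0" unfolding uminus_ptensor_def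
    by transfer (simp add: pcauchy_rel_refl pcauchy_const)
  show "x - y = x + - y"
    by (simp add: minus_ptensor_def uminus_ptensor_def)
  show "a *\<^sub>R (x + y) = a *\<^sub>R x + a *\<^sub>R y"
    by transfer (auto simp: scaleR_add_right dest!: pcauchy_rel_D
        intro!: pcauchy_rel_refl pcauchy_add pcauchy_scaleR)
  show "(a + b) *\<^sub>R x = a *\<^sub>R x + b *\<^sub>R x"
    by transfer (auto simp: scaleR_add_left dest!: pcauchy_rel_D
        intro!: pcauchy_rel_refl pcauchy_add pcauchy_scaleR)
  show "a *\<^sub>R b *\<^sub>R x = (a * b) *\<^sub>R x"
    by transfer (auto dest!: pcauchy_rel_D intro!: pcauchy_rel_refl pcauchy_scaleR)
  show "1 *\<^sub>R x = x"
    by transfer simp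
  show "sgn x = inverse (norm x) *\<^sub>R x"
    by (rule sgn_ptensor_def)
  show "dist x y = norm (x - y)"
    by (rule dist_ptensor_def)
  show "(uniformity :: (('a, 'b) ptensor \<times> ('a, 'b) ptensor) filter) =
      (INF e\<in>{0 <..}. principal {(x, y). dist x y < e})"
    by (rule uniformity_ptensor_def)
  show "open U = (\<forall>x\<in>U. \<forall>\<^sub>F (x', y) in uniformity. x' = x \<longrightarrow> y \<in> U)" for U :: "('a, 'b) ptensor set"
    by (rule open_ptensor_def)
  show "norm x = 0 \<longleftrightarrow> x = 0"
  proof transfer
    fix X :: "nat \<Rightarrow> ('a, 'b) alg_tensor"
    assume "pcauchy_rel X X"
    then have X: "pcauchy X" by (rule pcauchy_rel_D)
    show "lim (\<lambda>n. proj_norm (X n)) = 0 \<longleftrightarrow> pcauchy_rel X (\<lambda>n. 0)"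
      using X pcauchy_lim[OF X] by (auto simp: pcauchy_rel_def pcauchy_const intro: limI)
  qed
  show "norm (x + y) \<le> norm x + norm y"
  proof transfer
    fix X Y :: "nat \<Rightarrow> ('a, 'b) alg_tensor"
    assume "pcauchy_rel X X" "pcauchy_rel Y Y"
    then have X: "pcauchy X" and Y: "pcauchy Y" by (auto dest: pcauchy_rel_D)
    show "lim (\<lambda>n. proj_norm (X n + Y n)) \<le> lim (\<lambda>n. proj_norm (X n)) + lim (\<lambda>n. proj_norm (Y n))"
      by (rule LIMSEQ_le[OF pcauchy_lim[OF pcauchy_add[OF X Y]]
            tendsto_add[OF pcauchy_lim[OF X] pcauchy_lim[OF Y]]]) (auto intro: proj_norm_add)
  qed
  show "norm (a *\<^sub>R x) = \<bar>a\<bar> * norm x"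
  proof transfer
    fix a and X :: "nat \<Rightarrow> ('a, 'b) alg_tensor"
    assume "pcauchy_rel X X"
    then have X: "pcauchy X" by (rule pcauchy_rel_D)
    show "lim (\<lambda>n. proj_norm (a *\<^sub>R X n)) = \<bar>a\<bar> * lim (\<lambda>n. proj_norm (X n))"
      unfolding proj_norm_scaleR by (intro limI tendsto_mult_left pcauchy_lim[OF X])
  qed
qed

end

lift_definition embed_tensor :: "('a::real_normed_vector, 'b::real_normed_vector) alg_tensor \<Rightarrow> ('a, 'b) ptensor"
  is "\<lambda>z n. z"
  by (simp add: pcauchy_rel_refl pcauchy_const)

definition tensor :: "'a::real_normed_vector \<Rightarrow> 'b::real_normed_vector \<Rightarrow> ('a, 'b) ptensor"  (infixr \<open>\<otimes>\<^sub>\<pi>\<close> 75)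
  where "x \<otimes>\<^sub>\<pi> y = embed_tensor (list_tensor [(x, y)])"

lemma linear_embed_tensor: "linear embed_tensor"
  by (rule linearI; transfer; simp add: pcauchy_rel_refl pcauchy_const)

lemma norm_embed_tensor: "norm (embed_tensor z) = proj_norm z"
  by transfer simp

lemma bilinear_tensor: "bilinear (\<otimes>\<^sub>\<pi>)"
  unfolding bilinear_def tensor_def
  by (intro conjI allI linearI;
      simp only: linear_add[OF linear_embed_tensor, symmetric]
        linear_scale[OF linear_embed_tensor, symmetric]
        bilinear_ladd[OF bilinear_elementary] bilinear_radd[OF bilinear_elementary]
        bilinear_lmul[OF bilinear_elementary] bilinear_rmul[OF bilinear_elementary])

lemma norm_diff_embed_tensor:
  assumes "pcauchy X"
  shows "(\<lambda>m. norm (embed_tensor (X m) - abs_ptensor X)) \<longlonglongrightarrow> 0"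
proof -
  have eq: "norm (embed_tensor (X m) - abs_ptensor X) = lim (\<lambda>n. proj_norm (X m - X n))" for m
  proof -
    have X: "pcauchy_rel X X" and Xm: "pcauchy_rel (\<lambda>n. X m) (\<lambda>n. X m)"
      and nX: "pcauchy_rel (\<lambda>n. (-1) *\<^sub>R X n) (\<lambda>n. (-1) *\<^sub>R X n)"
      and D: "pcauchy_rel (\<lambda>n. X m + (-1) *\<^sub>R X n) (\<lambda>n. X m + (-1) *\<^sub>R X n)"
      using assms by (intro pcauchy_rel_refl pcauchy_add pcauchy_scaleR pcauchy_const; simp)+
    show ?thesis
      unfolding minus_ptensor_def embed_tensor.abs_eq scaleR_ptensor.abs_eq[OF X]
        plus_ptensor.abs_eq[OF Xm nX] norm_ptensor.abs_eq[OF D]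
      by simp
  qed
  show ?thesis
  proof (rule LIMSEQ_I)
    fix r :: real assume "0 < r"
    then obtain N where N: "\<And>m n. m \<ge> N \<Longrightarrow> n \<ge> N \<Longrightarrow> proj_norm (X m - X n) < r / 2"
      using assms unfolding pcauchy_def by (meson half_gt_zero)
    have "norm (embed_tensor (X m) - abs_ptensor X) \<le> r / 2" if "m \<ge> N" for m
    proof -
      have "pcauchy (\<lambda>n. X m - X n)"
        using pcauchy_add[OF pcauchy_const pcauchy_scaleR[OF assms], of "X m" "-1"] by simp
      from pcauchy_lim[OF this] show ?thesis unfolding eq
        by (rule LIMSEQ_le_const2) (use N[OF that] in \<open>auto intro!: exI[of _ N] less_imp_le\<close>)
    qed
    then show "\<exists>N. \<forall>m\<ge>N. norm (norm (embed_tensor (X m) - abs_ptensor X) - 0) < r"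
      using \<open>0 < r\<close> by (intro exI[of _ N]) fastforce
  qed
qed

lemma ptensor_approx:
  assumes "0 < e" shows "\<exists>z. norm (embed_tensor z - x) < e"
proof -
  obtain X where X: "pcauchy X" and x: "x = abs_ptensor X"
    using Quotient3_abs_rep[OF Quotient3_ptensor, of x] Quotient3_rep_reflp[OF Quotient3_ptensor, of x]
      pcauchy_rel_D by metis
  from LIMSEQ_D[OF norm_diff_embed_tensor[OF X] assms] show ?thesis
    unfolding x by auto
qed

lemma closure_span_tensor: "closure (span {x \<otimes>\<^sub>\<pi> y | x y. True}) = UNIV"
proof -
  have "embed_tensor (list_tensor zs) \<in> span {x \<otimes>\<^sub>\<pi> y | x y. True}" for zs :: "('a \<times> 'b) list"
  proof (induction zs)
    case Nil
    show ?case by (simp add: list_tensor_Nil linear_0[OF linear_embed_tensor] span_zero)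
  next
    case (Cons z zs)
    have "embed_tensor (list_tensor [z]) \<in> span {x \<otimes>\<^sub>\<pi> y | x y. True}"
      by (cases z) (auto simp: tensor_def intro!: span_base)
    with Cons show ?case
      by (subst list_tensor_Cons) (simp add: linear_add[OF linear_embed_tensor] span_add)
  qed
  then have span: "embed_tensor z \<in> span {x \<otimes>\<^sub>\<pi> y | x y. True}" for z :: "('a, 'b) alg_tensor"
    by (cases z rule: list_tensor_cases) simp
  have "t \<in> closure (span {x \<otimes>\<^sub>\<pi> y | x y. True})" for t :: "('a, 'b) ptensor"
    unfolding closure_approachable dist_norm
  proof (intro allI impI)
    fix e :: real assume "0 < e"
    then obtain z where "norm (embed_tensor z - t) < e" using ptensor_approx by blast
    then show "\<exists>y\<in>span {x \<otimes>\<^sub>\<pi> y | x y. True}. norm (y - t) < e"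
      using span[of z] by (rule bexI)
  qed
  then show ?thesis by (intro UNIV_eq_I[symmetric])
qed

instance ptensor :: (real_normed_vector, real_normed_vector) banach
proof
  fix Z :: "nat \<Rightarrow> ('a, 'b) ptensor"
  assume "Cauchy Z"
  have "\<exists>z. norm (embed_tensor z - Z n) < inverse (real (Suc n))" for n
    by (rule ptensor_approx) simp
  then obtain a where a: "\<And>n. norm (embed_tensor (a n) - Z n) < inverse (real (Suc n))"
    by metis
  have "(\<lambda>n. norm (embed_tensor (a n) - Z n)) \<longlonglongrightarrow> 0"
    by (rule tendsto_sandwich[OF _ _ tendsto_const LIMSEQ_inverse_real_of_nat])
       (intro always_eventually allI norm_ge_zero less_imp_le[OF a])+
  then have diff: "(\<lambda>n. embed_tensor (a n) - Z n) \<longlonglongrightarrow> 0"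
    by (rule tendsto_norm_zero_cancel)
  have "Cauchy (\<lambda>n. embed_tensor (a n))"
  proof (rule CauchyI)
    fix e :: real assume "0 < e"
    then have e: "0 < e / 2" by simp
    have "Cauchy (\<lambda>n. embed_tensor (a n) - Z n)"
      using diff by (rule LIMSEQ_imp_Cauchy)
    from CauchyD[OF this e] obtain M where M:
      "\<And>m n. m \<ge> M \<Longrightarrow> n \<ge> M \<Longrightarrow> norm ((embed_tensor (a m) - Z m) - (embed_tensor (a n) - Z n)) < e / 2"
      by blast
    from CauchyD[OF \<open>Cauchy Z\<close> e] obtain N where N:
      "\<And>m n. m \<ge> N \<Longrightarrow> n \<ge> N \<Longrightarrow> norm (Z m - Z n) < e / 2"
      by blast
    have "norm (embed_tensor (a m) - embed_tensor (a n)) < e" if "m \<ge> max M N" "n \<ge> max M N" for m n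
    proof -
      have "norm (embed_tensor (a m) - embed_tensor (a n))
          = norm (((embed_tensor (a m) - Z m) - (embed_tensor (a n) - Z n)) + (Z m - Z n))"
        by (simp add: algebra_simps)
      also have "\<dots> < e / 2 + e / 2"
        using M[of m n] N[of m n] that
        by (intro order_le_less_trans[OF norm_triangle_ineq] add_strict_mono) auto
      finally show ?thesis by simp
    qed
    then show "\<exists>M. \<forall>m\<ge>M. \<forall>n\<ge>M. norm (embed_tensor (a m) - embed_tensor (a n)) < e" by blast
  qed
  moreover have "norm (embed_tensor (a m) - embed_tensor (a n)) = proj_norm (a m - a n)" for m n
    by (metis linear_diff[OF linear_embed_tensor] norm_embed_tensor)
  ultimately have "pcauchy a"
    unfolding Cauchy_def pcauchy_def dist_norm by simp
  then have "(\<lambda>n. embed_tensor (a n) - abs_ptensor a) \<longlonglongrightarrow> 0"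
    by (rule tendsto_norm_zero_cancel[OF norm_diff_embed_tensor])
  then have "(\<lambda>n. embed_tensor (a n)) \<longlonglongrightarrow> abs_ptensor a"
    by (rule LIM_zero_cancel)
  then have "(\<lambda>n. embed_tensor (a n) - (embed_tensor (a n) - Z n)) \<longlonglongrightarrow> abs_ptensor a - 0"
    using diff by (rule tendsto_diff)
  then show "convergent Z" by (auto simp: convergent_def)
qed


section \<open>The symmetric projective tensor product\<close>

definition sym_tensors :: "('a::real_normed_vector, 'a) ptensor set" where
  "sym_tensors = closure (span (range (\<lambda>u. u \<otimes>\<^sub>\<pi> u)))"

lemma subspace_sym_tensors: "subspace sym_tensors"
  unfolding subspace_def
proof (intro conjI ballI allI)
  let ?S = "span (range (\<lambda>u::'a. u \<otimes>\<^sub>\<pi> u))"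
  show "0 \<in> (sym_tensors :: ('a, 'a) ptensor set)"
    unfolding sym_tensors_def by (rule subsetD[OF closure_subset span_zero])
  fix x y :: "('a, 'a) ptensor"
  assume "x \<in> sym_tensors" "y \<in> sym_tensors"
  then obtain f g where f: "\<And>n. f n \<in> ?S" "f \<longlonglongrightarrow> x" and g: "\<And>n. g n \<in> ?S" "g \<longlonglongrightarrow> y"
    unfolding sym_tensors_def closure_sequential by blast
  show "x + y \<in> sym_tensors"
    unfolding sym_tensors_def closure_sequential
    using f g by (intro exI[of _ "\<lambda>n. f n + g n"]) (auto intro: span_add tendsto_add)
next
  fix c :: real and x :: "('a, 'a) ptensor"
  let ?S = "span (range (\<lambda>u::'a. u \<otimes>\<^sub>\<pi> u))"
  assume "x \<in> sym_tensors"
  then obtain f where f: "\<And>n. f n \<in> ?S" "f \<longlonglongrightarrow> x"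
    unfolding sym_tensors_def closure_sequential by blast
  then show "c *\<^sub>R x \<in> sym_tensors"
    unfolding sym_tensors_def closure_sequential
    by (intro exI[of _ "\<lambda>n. c *\<^sub>R f n"]) (auto intro: span_scale tendsto_scaleR)
qed

lemma closed_sym_tensors: "closed sym_tensors"
  by (simp add: sym_tensors_def)

typedef (overloaded) 'a sym_ptensor = "sym_tensors :: ('a::real_normed_vector, 'a) ptensor set"
  using subspace_0[OF subspace_sym_tensors] by blast

setup_lifting type_definition_sym_ptensor

instantiation sym_ptensor :: (real_normed_vector) real_normed_vector
begin

lift_definition zero_sym_ptensor :: "'a sym_ptensor" is 0
  by (rule subspace_0[OF subspace_sym_tensors])

lift_definition plus_sym_ptensor :: "'a sym_ptensor \<Rightarrow> 'a sym_ptensor \<Rightarrow> 'a sym_ptensor" is "(+)"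
  by (rule subspace_add[OF subspace_sym_tensors])

lift_definition minus_sym_ptensor :: "'a sym_ptensor \<Rightarrow> 'a sym_ptensor \<Rightarrow> 'a sym_ptensor" is "(-)"
  by (rule subspace_diff[OF subspace_sym_tensors])

lift_definition uminus_sym_ptensor :: "'a sym_ptensor \<Rightarrow> 'a sym_ptensor" is uminus
  by (rule subspace_neg[OF subspace_sym_tensors])

lift_definition scaleR_sym_ptensor :: "real \<Rightarrow> 'a sym_ptensor \<Rightarrow> 'a sym_ptensor" is "(*\<^sub>R)"
  by (rule subspace_scale[OF subspace_sym_tensors])

lift_definition norm_sym_ptensor :: "'a sym_ptensor \<Rightarrow> real" is norm .

definition dist_sym_ptensor :: "'a sym_ptensor \<Rightarrow> 'a sym_ptensor \<Rightarrow> real"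
  where "dist_sym_ptensor x y = norm (x - y)"

definition uniformity_sym_ptensor :: "('a sym_ptensor \<times> 'a sym_ptensor) filter"
  where "uniformity_sym_ptensor = (INF e\<in>{0 <..}. principal {(x, y). dist x y < e})"

definition open_sym_ptensor :: "'a sym_ptensor set \<Rightarrow> bool"
  where "open_sym_ptensor S = (\<forall>x\<in>S. \<forall>\<^sub>F (x', y) in uniformity. x' = x \<longrightarrow> y \<in> S)"

definition sgn_sym_ptensor :: "'a sym_ptensor \<Rightarrow> 'a sym_ptensor"
  where "sgn_sym_ptensor x = inverse (norm x) *\<^sub>R x"

instance
proof
  fix x y z :: "'a sym_ptensor" and a b :: real
  show "x + y + z = x + (y + z)" by transfer (rule add.assoc)
  show "x + y = y + x" by transfer (rule add.commute)
  show "0 + x = x" by transfer (rule add_0)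
  show "- x + x = 0" by transfer (rule left_minus)
  show "x - y = x + - y" by transfer (rule diff_conv_add_uminus)
  show "a *\<^sub>R (x + y) = a *\<^sub>R x + a *\<^sub>R y" by transfer (rule scaleR_add_right)
  show "(a + b) *\<^sub>R x = a *\<^sub>R x + b *\<^sub>R x" by transfer (rule scaleR_add_left)
  show "a *\<^sub>R b *\<^sub>R x = (a * b) *\<^sub>R x" by transfer (rule scaleR_scaleR)
  show "1 *\<^sub>R x = x" by transfer (rule scaleR_one)
  show "norm x = 0 \<longleftrightarrow> x = 0" by transfer (rule norm_eq_zero)
  show "norm (x + y) \<le> norm x + norm y" by transfer (rule norm_triangle_ineq)
  show "norm (a *\<^sub>R x) = \<bar>a\<bar> * norm x" by transfer (rule norm_scaleR)
qed (rule dist_sym_ptensor_def uniformity_sym_ptensor_def open_sym_ptensor_def sgn_sym_ptensor_def)+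

end

instance sym_ptensor :: (real_normed_vector) banach
proof
  fix Z :: "nat \<Rightarrow> 'a sym_ptensor"
  assume "Cauchy Z"
  have dist_Rep: "dist (Rep_sym_ptensor x) (Rep_sym_ptensor y) = dist x y" for x y :: "'a sym_ptensor"
    unfolding dist_norm by transfer simp
  have "Cauchy (\<lambda>n. Rep_sym_ptensor (Z n))"
    using \<open>Cauchy Z\<close> by (simp add: Cauchy_def dist_Rep)
  then obtain l where l: "(\<lambda>n. Rep_sym_ptensor (Z n)) \<longlonglongrightarrow> l"
    by (auto simp: Cauchy_convergent_iff convergent_def)
  have "l \<in> sym_tensors"
    by (rule closed_sequentially[OF closed_sym_tensors Rep_sym_ptensor l])
  then have "l = Rep_sym_ptensor (Abs_sym_ptensor l)" by (simp add: Abs_sym_ptensor_inverse)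
  with l have "(\<lambda>n. Rep_sym_ptensor (Z n)) \<longlonglongrightarrow> Rep_sym_ptensor (Abs_sym_ptensor l)" by simp
  then have "Z \<longlonglongrightarrow> Abs_sym_ptensor l"
    by (simp add: lim_sequentially dist_Rep)
  then show "convergent Z" by (auto simp: convergent_def)
qed

lift_definition tensor_square :: "'a::real_normed_vector \<Rightarrow> 'a sym_ptensor" is "\<lambda>u. u \<otimes>\<^sub>\<pi> u"
  unfolding sym_tensors_def by (intro subsetD[OF closure_subset] span_base) auto


section \<open>Diconvexity and the dilinear subdifferential\<close>

definition proper_functional :: "('c \<Rightarrow> ereal) \<Rightarrow> bool" where
  "proper_functional f \<longleftrightarrow> (\<forall>x. f x \<noteq> -\<infinity>) \<and> (\<exists>x. f x \<noteq> \<infinity>)"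

definition convex_functional :: "('c::real_vector \<Rightarrow> ereal) \<Rightarrow> bool" where
  "convex_functional f \<longleftrightarrow>
    (\<forall>x y. \<forall>t::real. 0 < t \<longrightarrow> t < 1 \<longrightarrow>
      f ((1 - t) *\<^sub>R x + t *\<^sub>R y) \<le> ereal (1 - t) * f x + ereal t * f y)"

definition diconvex :: "('a::banach \<Rightarrow> ereal) \<Rightarrow> bool" where
  "diconvex F \<longleftrightarrow>
    (\<exists>\<Phi> :: 'a \<times> 'a sym_ptensor \<Rightarrow> ereal. proper_functional \<Phi> \<and> convex_functional \<Phi> \<and>
      (\<forall>u. F u = \<Phi> (u, tensor_square u)))"

definition dilinear_subdifferential ::
    "('a::banach \<Rightarrow> ereal) \<Rightarrow> 'a \<Rightarrow> (('a \<Rightarrow>\<^sub>L real) \<times> ('a sym_ptensor \<Rightarrow>\<^sub>L real)) set" where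
  "dilinear_subdifferential F u =
    {(\<xi>, \<Xi>). \<bar>F u\<bar> \<noteq> \<infinity> \<and>
      (\<forall>v. F v \<ge> F u + ereal (blinfun_apply \<xi> (v - u))
                    + ereal (blinfun_apply \<Xi> (tensor_square v - tensor_square u)))}"

end

theory Submission
  imports Defs
begin

text \<open>Both subgradient inequalities hold at the same test point \<open>v\<close>, and the dual
  pairings are additive in the functional, so adding the inequalities gives the one for the sum.
  Only the extended-real arithmetic needs care: finiteness of \<open>F u\<close> and
  \<open>G u\<close> justifies regrouping the lower bounds.\<close>

theorem proposition3p10:
  fixes F G :: "'a::banach \<Rightarrow> ereal"
  assumes "diconvex F" and "diconvex G"
  shows "\<forall>u. dilinear_subdifferential F u + dilinear_subdifferential G u
           \<subseteq> dilinear_subdifferential (\<lambda>v. F v + G v) u"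
proof (intro allI subsetI)
  fix u :: 'a and p
  assume "p \<in> dilinear_subdifferential F u + dilinear_subdifferential G u"
  then obtain \<xi> \<Xi> \<eta> \<Theta> where p: "p = (\<xi> + \<eta>, \<Xi> + \<Theta>)"
    and F: "(\<xi>, \<Xi>) \<in> dilinear_subdifferential F u"
    and G: "(\<eta>, \<Theta>) \<in> dilinear_subdifferential G u"
    by (auto elim!: set_plus_elim)
  \<comment> \<open>Membership in a subdifferential includes finiteness at \<open>u\<close>; with
    real \<open>a\<close> and \<open>b\<close> the regrouping below is real arithmetic.\<close>
  obtain a b where ab: "F u = ereal a" "G u = ereal b"
    using F G by (auto simp: dilinear_subdifferential_def)
  have "F u + G u + ereal (blinfun_apply (\<xi> + \<eta>) (v - u))
          + ereal (blinfun_apply (\<Xi> + \<Theta>) (tensor_square v - tensor_square u)) \<le> F v + G v" for v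
  proof -
    let ?d = "v - u" and ?D = "tensor_square v - tensor_square u"
    have "F u + G u + ereal (blinfun_apply (\<xi> + \<eta>) ?d) + ereal (blinfun_apply (\<Xi> + \<Theta>) ?D)
        = (F u + ereal (blinfun_apply \<xi> ?d) + ereal (blinfun_apply \<Xi> ?D))
          + (G u + ereal (blinfun_apply \<eta> ?d) + ereal (blinfun_apply \<Theta> ?D))"
      by (simp add: ab blinfun.add_left)
    \<comment> \<open>Here \<open>F v\<close> or \<open>G v\<close> may be infinite, but addition is
      monotone on \<open>ereal\<close>. The real lower bounds exclude the value
      \<open>-\<infinity>\<close>, so no \<open>\<infinity> - \<infinity>\<close> arises.\<close>
    also have "\<dots> \<le> F v + G v"
      using F G unfolding dilinear_subdifferential_def by (intro add_mono) blast+
    finally show ?thesis .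
  qed
  then show "p \<in> dilinear_subdifferential (\<lambda>v. F v + G v) u"
    \<comment> \<open>Here \<open>ab\<close> also yields that \<open>F u + G u\<close> is
      finite.\<close>
    by (simp add: p ab dilinear_subdifferential_def)
qed

end
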